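(* Let $(A,R)$ be a Rota-Baxter 3-Lie algebra of weight $\lambda$, let $(V,R_V)$ be an abelian Rota-Baxter 3-Lie algebra (trivial product), let $0\to(V,R_V)\xrightarrow{i}(\hat A,R_{\hat A})\xrightarrow{p}(A,R)\to0$ be a central extension, and let $s:A\to\hat A$ be any section, i.e. a linear map with $ps=I$. Identifying $V$ with $i(V)$, define $\psi:\wedge^3A\to V$ and $\chi:A\to V$ by $$\psi(x,y,z)=[s(x),s(y),s(z)]-s[x,y,z],\qquad \chi(x)=R_{\hat A}(s(x))-s(R(x)).$$ Then the vector space $A\oplus V$ with the bracket $$[x+a,y+b,z+c]_\psi=[x,y,z]+\psi(x,y,z)$$ and the operator $$R_\chi(x+a)=R(x)+R_V(a)+\chi(x)$$ ($x,y,z\in A$, $a,b,c\in V$) is a Rota-Baxter 3-Lie algebra (of weight $\lambda$) if and only if $(\psi,\chi)$ is a 2-cocycle of $(A,R)$ with coefficients in the trivial representation $(V,R_V)$.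
   Context: Fix a field $k$ and $\lambda\in k$. A 3-Lie algebra is a vector space $A$ with a linear map $[\cdot,\cdot,\cdot]:\wedge^3A\to A$ satisfying $[x_1,x_2,[y_1,y_2,y_3]]=[[x_1,x_2,y_1],y_2,y_3]+[y_1,[x_1,x_2,y_2],y_3]+[y_1,y_2,[x_1,x_2,y_3]]$. A Rota-Baxter operator of weight $\lambda$ on $A$ is a linear map $R:A\to A$ with $[Rx,Ry,Rz]=R([x,y,z]_R)$, where $$[x,y,z]_R=[Rx,Ry,z]+[Rx,y,Rz]+[x,Ry,Rz]+\lambda([Rx,y,z]+[x,Ry,z]+[x,y,Rz])+\lambda^2[x,y,z];$$ then $(A,R)$ is a Rota-Baxter 3-Lie algebra of weight $\lambda$. The space $A$ with $[\cdot,\cdot,\cdot]_R$ is again a 3-Lie algebra, denoted $A_R$. Homomorphisms of Rota-Baxter 3-Lie algebras are linear maps preserving brackets and commuting with the Rota-Baxter operators. A central extension of $(A,R)$ by the abelian $(V,R_V)$ is an exact sequence of Rota-Baxter 3-Lie algebras $0\to(V,R_V)\xrightarrow{i}(\hat A,R_{\hat A})\xrightarrow{p}(A,R)\to0$ such that $[V,V,\hat A]=[V,\hat A,V]=[\hat A,V,V]=0$. A representation of a 3-Lie algebra $A$ is a vector space $V$ with a skew-symmetric bilinear map $\rho:A\wedge A\to\mathfrak{gl}(V)$ such that $\rho(x_1,x_2)\rho(x_3,x_4)-\rho(x_3,x_4)\rho(x_1,x_2)=\rho([x_1,x_2,x_3],x_4)-\rho([x_1,x_2,x_4],x_3)$ and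 $\rho([x_1,x_2,x_3],x_4)=\rho(x_1,x_2)\rho(x_3,x_4)+\rho(x_2,x_3)\rho(x_1,x_4)+\rho(x_3,x_1)\rho(x_2,x_4)$. A representation of $(A,R)$ is a triple $(V,R_V,\rho)$ with $(V,\rho)$ a representation of $A$ and $R_V:V\to V$ linear such that $$\rho(Rx_1,Rx_2)R_V=R_V\rho(Rx_1,Rx_2)+R_V S(x_1,x_2)R_V+\lambda R_V S(x_1,x_2),\quad S(x_1,x_2)=\rho(Rx_1,x_2)+\rho(x_1,Rx_2)+\lambda\rho(x_1,x_2).$$ $\tilde V$ denotes $V$ with $\tilde\rho(x_1,x_2)=\rho(Rx_1,Rx_2)-R_VS(x_1,x_2)$, a representation of $A_R$. The trivial representation $(V,R_V)$ is the one with $\rho=0$ (so $\tilde\rho=0$). Cochains: for a 3-Lie algebra $A$, a representation $(V,\rho)$ and $p\ge1$, with $L=\wedge^2A$, $C_{\rm 3\text{-}Lie}^{p}(A,V)$ is the space of linear maps $f:L^{\otimes(p-1)}\wedge A\to V$, i.e. multilinear maps $f(X_1,\dots,X_{p-1},z)$ with $X_i=x_i\wedge y_i\in L$, $z\in A$, alternating in the last three entries $x_{p-1},y_{p-1},z$ when $p\ge2$. Write $[X,z]=[x,y,z]$ and $\rho(X)=\rho(x,y)$ for $X=x\wedge y$, and $[X,Y]_F=[x_1,x_2,y_1]\wedge y_2+y_1\wedge[x_1,x_2,y_2]$ for $X=x_1\wedge x_2$, $Y=y_1\wedge y_2$. The coboundary is $$\begin{aligned}(\partial f)(X_1,\dots,X_p,z)=&\sum_{1\le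 i<k\le p}(-1)^i f(X_1,\dots,\hat X_i,\dots,X_{k-1},[X_i,X_k]_F,X_{k+1},\dots,X_p,z)\\&+\sum_{i=1}^p(-1)^i f(X_1,\dots,\hat X_i,\dots,X_p,[X_i,z])+\sum_{i=1}^p(-1)^{i+1}\rho(X_i)f(X_1,\dots,\hat X_i,\dots,X_p,z)\\&+(-1)^{p+1}\big(\rho(y_p,z)f(X_1,\dots,X_{p-1},x_p)+\rho(z,x_p)f(X_1,\dots,X_{p-1},y_p)\big).\end{aligned}$$ $\partial_R$ is this same coboundary for $A_R$ (all brackets replaced by $[\cdot,\cdot,\cdot]_R$) with coefficients in $\tilde V$ ($\rho$ replaced by $\tilde\rho$). The map $\delta:C_{\rm 3\text{-}Lie}^{n+1}(A,V)\to C_{\rm 3\text{-}Lie}^{n+1}(A_R,\tilde V)$ is, with arguments $x_1,\dots,x_{2n+1}\in A$, $$\delta f(x_1,\dots,x_{2n+1})=f(Rx_1,\dots,Rx_{2n+1})-R_V\sum_{k=0}^{2n}\lambda^{2n-k}f^{k}(x_1,\dots,x_{2n+1}),$$ where $f^k$ is the sum, over all choices of $k$ of the positions, of $f$ with $R$ applied to the arguments in the chosen positions and the identity elsewhere; $\lambda^0=1$. $C_{\rm RB}^{2}(A,V)=C_{\rm 3\text{-}Lie}^{2}(A,V)\times C_{\rm 3\text{-}Lie}^{1}(A_R,\tilde V)$, and a 2-cocycle of $(A,R)$ with coefficients in $(V,R_V,\rho)$ is an element $(f,g)\in C_{\rm RB}^{2}(A,V)$ with $\partial_{RB}(f,g)=(\partial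 f,\partial_Rg+\delta f)=0$. *)

theory Defs
  imports "HOL-Analysis.Product_Vector"
begin

text \<open>A linear map on the third exterior power is an alternating trilinear map. Alternating means
  vanishing on repeated arguments, which is stronger than skew-symmetry in characteristic 2.\<close>

locale three_lie_algebra = vector_space sA
  for sA :: "'k::field \<Rightarrow> 'a::ab_group_add \<Rightarrow> 'a" +
  fixes br :: "'a \<Rightarrow> 'a \<Rightarrow> 'a \<Rightarrow> 'a"
  assumes linear_1: "Vector_Spaces.linear sA sA (\<lambda>x. br x y z)"
    and linear_2: "Vector_Spaces.linear sA sA (\<lambda>y. br x y z)"
    and linear_3: "Vector_Spaces.linear sA sA (\<lambda>z. br x y z)"
    and alternating: "br x x z = 0" "br x z z = 0" "br x z x = 0"
    and fundamental_identity:
      "br x1 x2 (br y1 y2 y3) =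
        br (br x1 x2 y1) y2 y3 + br y1 (br x1 x2 y2) y3 + br y1 y2 (br x1 x2 y3)"

definition rb_bracket ::
  "'k::field \<Rightarrow> ('k \<Rightarrow> 'a::ab_group_add \<Rightarrow> 'a) \<Rightarrow> ('a \<Rightarrow> 'a \<Rightarrow> 'a \<Rightarrow> 'a) \<Rightarrow> ('a \<Rightarrow> 'a) \<Rightarrow>
    'a \<Rightarrow> 'a \<Rightarrow> 'a \<Rightarrow> 'a" where
  "rb_bracket lam sA br R x y z =
    br (R x) (R y) z + br (R x) y (R z) + br x (R y) (R z)
    + sA lam (br (R x) y z + br x (R y) z + br x y (R z))
    + sA (lam ^ 2) (br x y z)"

locale rota_baxter_3lie_algebra = three_lie_algebra sA br
  for lam :: "'k::field"
    and sA :: "'k \<Rightarrow> 'a::ab_group_add \<Rightarrow> 'a"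
    and br :: "'a \<Rightarrow> 'a \<Rightarrow> 'a \<Rightarrow> 'a"
    and R :: "'a \<Rightarrow> 'a" +
  assumes linear_R: "Vector_Spaces.linear sA sA R"
    and rota_baxter: "br (R x) (R y) (R z) = R (rb_bracket lam sA br R x y z)"

locale rota_baxter_3lie_hom = Vector_Spaces.linear sA sB f
  for sA :: "'k::field \<Rightarrow> 'a::ab_group_add \<Rightarrow> 'a"
    and brA :: "'a \<Rightarrow> 'a \<Rightarrow> 'a \<Rightarrow> 'a"
    and RA :: "'a \<Rightarrow> 'a"
    and sB :: "'k \<Rightarrow> 'b::ab_group_add \<Rightarrow> 'b"
    and brB :: "'b \<Rightarrow> 'b \<Rightarrow> 'b \<Rightarrow> 'b"
    and RB :: "'b \<Rightarrow> 'b"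
    and f :: "'a \<Rightarrow> 'b" +
  assumes hom_bracket: "f (brA x y z) = brB (f x) (f y) (f z)"
    and hom_R: "f (RA x) = RB (f x)"

locale rb_central_extension =
  A: rota_baxter_3lie_algebra lam sA brA RA +
  V: rota_baxter_3lie_algebra lam sV "\<lambda>_ _ _. 0" RV +
  E: rota_baxter_3lie_algebra lam sE brE RE +
  i: rota_baxter_3lie_hom sV "\<lambda>_ _ _. 0" RV sE brE RE i +
  p: rota_baxter_3lie_hom sE brE RE sA brA RA p
  for lam :: "'k::field"
    and sA :: "'k \<Rightarrow> 'a::ab_group_add \<Rightarrow> 'a"
    and brA :: "'a \<Rightarrow> 'a \<Rightarrow> 'a \<Rightarrow> 'a"
    and RA :: "'a \<Rightarrow> 'a"
    and sV :: "'k \<Rightarrow> 'v::ab_group_add \<Rightarrow> 'v"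
    and RV :: "'v \<Rightarrow> 'v"
    and sE :: "'k \<Rightarrow> 'e::ab_group_add \<Rightarrow> 'e"
    and brE :: "'e \<Rightarrow> 'e \<Rightarrow> 'e \<Rightarrow> 'e"
    and RE :: "'e \<Rightarrow> 'e"
    and i :: "'v \<Rightarrow> 'e"
    and p :: "'e \<Rightarrow> 'a" +
  assumes inj_i: "inj i"
    and exact: "range i = {e. p e = 0}"
    and surj_p: "surj p"
    and central: "brE (i a) (i b) e = 0" "brE (i a) e (i b) = 0" "brE e (i a) (i b) = 0"

locale three_lie_representation = three_lie_algebra sA br + V: vector_space sV
  for sA :: "'k::field \<Rightarrow> 'a::ab_group_add \<Rightarrow> 'a"
    and br :: "'a \<Rightarrow> 'a \<Rightarrow> 'a \<Rightarrow> 'a"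
    and sV :: "'k \<Rightarrow> 'v::ab_group_add \<Rightarrow> 'v" +
  fixes rho :: "'a \<Rightarrow> 'a \<Rightarrow> 'v \<Rightarrow> 'v"
  assumes rho_linear_1: "Vector_Spaces.linear sA sV (\<lambda>x. rho x y v)"
    and rho_linear_2: "Vector_Spaces.linear sA sV (\<lambda>y. rho x y v)"
    and rho_endo: "Vector_Spaces.linear sV sV (rho x y)"
    and rho_alternating: "rho x x v = 0"
    and rho_commutator:
      "rho x1 x2 (rho x3 x4 v) - rho x3 x4 (rho x1 x2 v) =
        rho (br x1 x2 x3) x4 v - rho (br x1 x2 x4) x3 v"
    and rho_bracket:
      "rho (br x1 x2 x3) x4 v =
        rho x1 x2 (rho x3 x4 v) + rho x2 x3 (rho x1 x4 v) + rho x3 x1 (rho x2 x4 v)"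

definition rho_S ::
  "'k::field \<Rightarrow> ('a \<Rightarrow> 'a) \<Rightarrow> ('k \<Rightarrow> 'v::ab_group_add \<Rightarrow> 'v) \<Rightarrow> ('a \<Rightarrow> 'a \<Rightarrow> 'v \<Rightarrow> 'v) \<Rightarrow>
    'a \<Rightarrow> 'a \<Rightarrow> 'v \<Rightarrow> 'v" where
  "rho_S lam R sV rho x y v = rho (R x) y v + rho x (R y) v + sV lam (rho x y v)"

locale rota_baxter_3lie_representation =
  rota_baxter_3lie_algebra lam sA br R + three_lie_representation sA br sV rho
  for lam :: "'k::field"
    and sA :: "'k \<Rightarrow> 'a::ab_group_add \<Rightarrow> 'a"
    and br :: "'a \<Rightarrow> 'a \<Rightarrow> 'a \<Rightarrow> 'a"
    and R :: "'a \<Rightarrow> 'a"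
    and sV :: "'k \<Rightarrow> 'v::ab_group_add \<Rightarrow> 'v"
    and RV :: "'v \<Rightarrow> 'v"
    and rho :: "'a \<Rightarrow> 'a \<Rightarrow> 'v \<Rightarrow> 'v" +
  assumes linear_RV: "Vector_Spaces.linear sV sV RV"
    and rho_rota_baxter:
      "rho (R x) (R y) (RV v) =
        RV (rho (R x) (R y) v) + RV (rho_S lam R sV rho x y (RV v))
        + sV lam (RV (rho_S lam R sV rho x y v))"

definition rho_tilde ::
  "'k::field \<Rightarrow> ('a \<Rightarrow> 'a) \<Rightarrow> ('k \<Rightarrow> 'v::ab_group_add \<Rightarrow> 'v) \<Rightarrow> ('v \<Rightarrow> 'v) \<Rightarrow>
    ('a \<Rightarrow> 'a \<Rightarrow> 'v \<Rightarrow> 'v) \<Rightarrow> 'a \<Rightarrow> 'a \<Rightarrow> 'v \<Rightarrow> 'v" where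
  "rho_tilde lam R sV RV rho x y v = rho (R x) (R y) v - RV (rho_S lam R sV rho x y v)"

definition trivial_rho :: "'a \<Rightarrow> 'a \<Rightarrow> 'v::ab_group_add \<Rightarrow> 'v" where
  "trivial_rho x y v = 0"

lemma trivial_representation:
  assumes "rota_baxter_3lie_algebra lam sA br R"
    and "rota_baxter_3lie_algebra lam sV (\<lambda>_ _ _. 0) RV"
  shows "rota_baxter_3lie_representation lam sA br R sV RV trivial_rho"
proof -
  interpret A: rota_baxter_3lie_algebra lam sA br R by fact
  interpret V: rota_baxter_3lie_algebra lam sV "\<lambda>_ _ _. 0" RV by fact
  interpret AV: vector_space_pair sA sV by unfold_locales
  interpret VV: vector_space_pair sV sV by unfold_locales
  interpret RV: Vector_Spaces.linear sV sV RV by (rule V.linear_R)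
  show ?thesis
    by unfold_locales
      (simp_all add: trivial_rho_def rho_S_def RV.zero AV.linear_0 VV.linear_0
        module_hom.add module_hom.scale RV.add RV.scale)
qed

text \<open>A cochain of degree \<open>p\<close> is evaluated on the list of the \<open>p - 1\<close> pairs
  \<open>X\<^sub>j = (x\<^sub>j, y\<^sub>j)\<close>, which stand for the decomposable elements
  \<open>x\<^sub>j \<and> y\<^sub>j\<close>, and on the last argument \<open>z\<close>. Values on lists of another
  length carry no information. The list indices are 0-based.\<close>

type_synonym ('a, 'v) cochain = "('a \<times> 'a) list \<Rightarrow> 'a \<Rightarrow> 'v"

definition is_cochain ::
  "('k::field \<Rightarrow> 'a::ab_group_add \<Rightarrow> 'a) \<Rightarrow> ('k \<Rightarrow> 'v::ab_group_add \<Rightarrow> 'v) \<Rightarrow>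
    nat \<Rightarrow> ('a, 'v) cochain \<Rightarrow> bool" where
  "is_cochain sA sV p f \<longleftrightarrow>
    (\<forall>Xs. length Xs = p - 1 \<longrightarrow>
      Vector_Spaces.linear sA sV (f Xs) \<and>
      (\<forall>j < p - 1. \<forall>x y z.
        Vector_Spaces.linear sA sV (\<lambda>x. f (Xs[j := (x, y)]) z) \<and>
        Vector_Spaces.linear sA sV (\<lambda>y. f (Xs[j := (x, y)]) z) \<and>
        f (Xs[j := (x, x)]) z = 0) \<and>
      (p \<ge> 2 \<longrightarrow> (\<forall>x y.
        f (Xs[p - 2 := (x, y)]) x = 0 \<and>
        f (Xs[p - 2 := (x, y)]) y = 0)))"

definition delete_nth :: "nat \<Rightarrow> 'b list \<Rightarrow> 'b list" where
  "delete_nth j xs = take j xs @ drop (Suc j) xs"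

text \<open>Since \<open>[X\<^sub>i, X\<^sub>k]\<^sub>F\<close> is a sum of two decomposable elements, \<open>f\<close> is
  evaluated on it as the sum of the two values. As the indices are shifted by one, the sign
  \<open>(-1)\<^sup>i\<close> becomes \<open>(-1) ^ Suc i\<close>. Here \<open>p\<close> is the length of
  \<open>Xs\<close>, which has to be positive.\<close>

definition coboundary ::
  "('k::field \<Rightarrow> 'v::ab_group_add \<Rightarrow> 'v) \<Rightarrow> ('a \<Rightarrow> 'a \<Rightarrow> 'a \<Rightarrow> 'a) \<Rightarrow> ('a \<Rightarrow> 'a \<Rightarrow> 'v \<Rightarrow> 'v) \<Rightarrow>
    ('a, 'v) cochain \<Rightarrow> ('a, 'v) cochain" where
  "coboundary sV br rho f Xs z =
    (let p = length Xs; x = (\<lambda>j. fst (Xs ! j)); y = (\<lambda>j. snd (Xs ! j)) in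
      (\<Sum>k<p. \<Sum>i<k. sV ((-1) ^ Suc i)
        (f (delete_nth i (Xs[k := (br (x i) (y i) (x k), y k)])) z
         + f (delete_nth i (Xs[k := (x k, br (x i) (y i) (y k))])) z))
      + (\<Sum>i<p. sV ((-1) ^ Suc i) (f (delete_nth i Xs) (br (x i) (y i) z)))
      + (\<Sum>i<p. sV ((-1) ^ i) (rho (x i) (y i) (f (delete_nth i Xs) z)))
      + sV ((-1) ^ Suc p)
          (rho (y (p - 1)) z (f (butlast Xs) (x (p - 1)))
           + rho z (x (p - 1)) (f (butlast Xs) (y (p - 1)))))"

text \<open>The positions of \<open>x\<^sub>j\<close>, \<open>y\<^sub>j\<close> and \<open>z\<close> among the
  \<open>2 n + 1\<close> arguments are \<open>2 j\<close>, \<open>2 j + 1\<close> and \<open>2 n\<close>;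
  \<open>S\<close> is the set of positions to which \<open>R\<close> is applied.\<close>

definition apply_at :: "('a \<Rightarrow> 'a) \<Rightarrow> nat set \<Rightarrow> nat \<Rightarrow> 'a \<Rightarrow> 'a" where
  "apply_at R S m x = (if m \<in> S then R x else x)"

definition partial_R :: "('a \<Rightarrow> 'a) \<Rightarrow> nat \<Rightarrow> ('a, 'v::ab_group_add) cochain \<Rightarrow> ('a, 'v) cochain" where
  "partial_R R k f Xs z =
    (\<Sum>S | S \<subseteq> {..2 * length Xs} \<and> card S = k.
      f (map (\<lambda>j. (apply_at R S (2 * j) (fst (Xs ! j)),
                    apply_at R S (2 * j + 1) (snd (Xs ! j)))) [0..<length Xs])
        (apply_at R S (2 * length Xs) z))"

definition rb_delta ::
  "'k::field \<Rightarrow> ('a \<Rightarrow> 'a) \<Rightarrow> ('k \<Rightarrow> 'v::ab_group_add \<Rightarrow> 'v) \<Rightarrow> ('v \<Rightarrow> 'v) \<Rightarrow>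
    ('a, 'v) cochain \<Rightarrow> ('a, 'v) cochain" where
  "rb_delta lam R sV RV f Xs z =
    f (map (map_prod R R) Xs) (R z)
    - RV (\<Sum>k\<le>2 * length Xs. sV (lam ^ (2 * length Xs - k)) (partial_R R k f Xs z))"

text \<open>The algebras \<open>A\<close> and \<open>A\<^sub>R\<close> have the same underlying vector space, and so do
  \<open>V\<close> and its twisted version, so their cochain spaces coincide.\<close>

definition rb_2cocycle ::
  "'k::field \<Rightarrow> ('k \<Rightarrow> 'a::ab_group_add \<Rightarrow> 'a) \<Rightarrow> ('a \<Rightarrow> 'a \<Rightarrow> 'a \<Rightarrow> 'a) \<Rightarrow> ('a \<Rightarrow> 'a) \<Rightarrow>
    ('k \<Rightarrow> 'v::ab_group_add \<Rightarrow> 'v) \<Rightarrow> ('v \<Rightarrow> 'v) \<Rightarrow> ('a \<Rightarrow> 'a \<Rightarrow> 'v \<Rightarrow> 'v) \<Rightarrow>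
    ('a, 'v) cochain \<Rightarrow> ('a, 'v) cochain \<Rightarrow> bool" where
  "rb_2cocycle lam sA br R sV RV rho f g \<longleftrightarrow>
    is_cochain sA sV 2 f \<and> is_cochain sA sV 1 g \<and>
    (\<forall>Xs z. length Xs = 2 \<longrightarrow> coboundary sV br rho f Xs z = 0) \<and>
    (\<forall>Xs z. length Xs = 1 \<longrightarrow>
      coboundary sV (rb_bracket lam sA br R) (rho_tilde lam R sV RV rho) g Xs z
      + rb_delta lam R sV RV f Xs z = 0)"

definition cochain_of_linear :: "('a \<Rightarrow> 'v) \<Rightarrow> ('a, 'v) cochain" where
  "cochain_of_linear chi Xs z = chi z"

definition cochain_of_trilinear :: "('a \<Rightarrow> 'a \<Rightarrow> 'a \<Rightarrow> 'v) \<Rightarrow> ('a, 'v) cochain" where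
  "cochain_of_trilinear psi Xs z = psi (fst (hd Xs)) (snd (hd Xs)) z"

definition psi_bracket ::
  "('a \<Rightarrow> 'a \<Rightarrow> 'a \<Rightarrow> 'a) \<Rightarrow> ('a \<Rightarrow> 'a \<Rightarrow> 'a \<Rightarrow> 'v) \<Rightarrow>
    'a \<times> 'v \<Rightarrow> 'a \<times> 'v \<Rightarrow> 'a \<times> 'v \<Rightarrow> 'a \<times> 'v" where
  "psi_bracket br psi = (\<lambda>(x, a) (y, b) (z, c). (br x y z, psi x y z))"

definition chi_operator ::
  "('a \<Rightarrow> 'a) \<Rightarrow> ('v::ab_group_add \<Rightarrow> 'v) \<Rightarrow> ('a \<Rightarrow> 'v) \<Rightarrow> 'a \<times> 'v \<Rightarrow> 'a \<times> 'v" where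
  "chi_operator R RV chi = (\<lambda>(x, a). (R x, RV a + chi x))"

end

theory Submission
  imports Defs
begin

text \<open>Each axiom of a Rota-Baxter 3-Lie algebra for the bracket
  \<open>[x + a, y + b, z + c] = [x, y, z] + \<psi>(x, y, z)\<close> and the operator
  \<open>x + a \<mapsto> R(x) + R\<^sub>V(a) + \<chi>(x)\<close> on \<open>A \<oplus> V\<close> is an
  equation between pairs. Its \<open>A\<close>-component is the same axiom for \<open>A\<close>, which holds.
  So everything is decided by the \<open>V\<close>-components, and these are exactly the clauses of the
  cocycle condition:

  \<^item> the bracket is trilinear and alternating iff \<open>\<psi>\<close> is a 2-cochain, and the
    operator is linear iff \<open>\<chi>\<close> is a 1-cochain;
  \<^item> the fundamental identity becomes \<open>\<partial>\<psi> = 0\<close>. With trivial coefficients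
    the four terms of \<open>\<partial>\<psi>\<close> that contain a bracket are the four terms of that
    identity with \<open>\<psi>\<close> as the outer bracket;
  \<^item> the Rota-Baxter identity becomes
    \<open>\<psi>(Rx, Ry, Rz) = R\<^sub>V(\<psi>\<^sub>R(x, y, z)) + \<chi>([x, y, z]\<^sub>R)\<close>, where
    \<open>\<psi>\<^sub>R\<close> is formed from \<open>\<psi>\<close> as \<open>[x, y, z]\<^sub>R\<close> is from the
    bracket. As \<open>\<partial>\<^sub>R\<chi> = - \<chi>([x, y, z]\<^sub>R)\<close> and
    \<open>\<delta>\<psi>\<close> is the difference of the other two terms, this is
    \<open>\<partial>\<^sub>R\<chi> + \<delta>\<psi> = 0\<close>.

  The lemmas \<open>coboundary_2_trivial\<close>, \<open>coboundary_1_trivial\<close> and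
  \<open>rb_delta_trilinear\<close> bring the cocycle condition into this form;
  \<open>three_lie_psi_bracket_iff\<close>, \<open>linear_triangular_iff\<close> and
  \<open>rb_bracket_psi_bracket\<close> do the same for the axioms on \<open>A \<oplus> V\<close>.\<close>

section \<open>The cocycle condition in low degree\<close>

definition alternating_trilinear ::
  "('k::field \<Rightarrow> 'a::ab_group_add \<Rightarrow> 'a) \<Rightarrow> ('k \<Rightarrow> 'v::ab_group_add \<Rightarrow> 'v) \<Rightarrow>
    ('a \<Rightarrow> 'a \<Rightarrow> 'a \<Rightarrow> 'v) \<Rightarrow> bool" where
  "alternating_trilinear sA sV psi \<longleftrightarrow>
    (\<forall>x y. Vector_Spaces.linear sA sV (\<lambda>w. psi w x y)) \<and>
    (\<forall>x y. Vector_Spaces.linear sA sV (\<lambda>w. psi x w y)) \<and>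
    (\<forall>x y. Vector_Spaces.linear sA sV (\<lambda>w. psi x y w)) \<and>
    (\<forall>x y. psi x x y = 0 \<and> psi x y y = 0 \<and> psi x y x = 0)"

lemma is_cochain_of_trilinear_iff:
  "is_cochain sA sV 2 (cochain_of_trilinear psi) \<longleftrightarrow> alternating_trilinear sA sV psi"
  (is "?L \<longleftrightarrow> ?R")
proof
  assume ?L
  then have L: "\<And>Xs. length Xs = 1 \<Longrightarrow>
      Vector_Spaces.linear sA sV (cochain_of_trilinear psi Xs) \<and>
      (\<forall>x y z.
        Vector_Spaces.linear sA sV (\<lambda>x. cochain_of_trilinear psi (Xs[0 := (x, y)]) z) \<and>
        Vector_Spaces.linear sA sV (\<lambda>y. cochain_of_trilinear psi (Xs[0 := (x, y)]) z) \<and>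
        cochain_of_trilinear psi (Xs[0 := (x, x)]) z = 0) \<and>
      (\<forall>x y. cochain_of_trilinear psi (Xs[0 := (x, y)]) x = 0 \<and>
        cochain_of_trilinear psi (Xs[0 := (x, y)]) y = 0)"
    unfolding is_cochain_def by simp
  show ?R
    unfolding alternating_trilinear_def
    using L[of "[(x, y)]" for x y] by (simp add: cochain_of_trilinear_def [abs_def])
next
  assume ?R
  then show ?L
    by (auto simp: is_cochain_def alternating_trilinear_def cochain_of_trilinear_def [abs_def]
        length_Suc_conv)
qed

lemma is_cochain_of_linear_iff:
  "is_cochain sA sV 1 (cochain_of_linear chi) \<longleftrightarrow> Vector_Spaces.linear sA sV chi"
  by (auto simp: is_cochain_def cochain_of_linear_def [abs_def])

text \<open>Of the sums in the coboundary, those through \<open>\<rho>\<close> vanish. The first sum has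
  only the index pair \<open>i = 1, k = 2\<close>, and the two decomposable parts of
  \<open>[X\<^sub>1, X\<^sub>2]\<^sub>F\<close> give the terms in which the inner bracket stands in the
  first or the second slot.\<close>

lemma coboundary_2_trivial:
  assumes "vector_space sV"
  shows "coboundary sV br trivial_rho (cochain_of_trilinear psi) [(x1, x2), (y1, y2)] z =
    psi x1 x2 (br y1 y2 z)
    - (psi (br x1 x2 y1) y2 z + psi y1 (br x1 x2 y2) z + psi y1 y2 (br x1 x2 z))"
proof -
  interpret vector_space sV by fact
  show ?thesis
    by (simp add: coboundary_def cochain_of_trilinear_def trivial_rho_def delete_nth_def
        numeral_2_eq_2 lessThan_Suc)
qed

lemma coboundary_1_trivial:
  assumes "vector_space sV" and "Vector_Spaces.linear sV sV RV"
  shows "coboundary sV br (rho_tilde lam R sV RV trivial_rho) (cochain_of_linear chi) [(x, y)] z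
    = - chi (br x y z)"
proof -
  interpret vector_space sV by fact
  interpret RV: Vector_Spaces.linear sV sV RV by fact
  show ?thesis
    by (simp add: coboundary_def cochain_of_linear_def rho_tilde_def rho_S_def trivial_rho_def
        delete_nth_def RV.zero)
qed

text \<open>A 2-cochain \<open>f\<close> has the three argument positions 0, 1, 2, so \<open>\<delta>f\<close>
  sums over their subsets with 0, 1 and 2 elements.\<close>

lemma subsets_of_three_positions:
  "{S. S \<subseteq> {..2::nat} \<and> card S = 0} = {{}}"
  "{S. S \<subseteq> {..2::nat} \<and> card S = 1} = {{0}, {1}, {2}}"
  "{S. S \<subseteq> {..2::nat} \<and> card S = 2} = {{0, 1}, {0, 2}, {1, 2}}"
proof -
  have "{..2::nat} = {0, 1, 2}"
    by auto
  then have Pow: "S \<subseteq> {..2::nat} \<longleftrightarrow> S \<in> Pow {0, 1, 2}" for S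
    by simp
  have "(S \<subseteq> {..2::nat} \<and> card S = 0) = (S \<in> {{}})"
    "(S \<subseteq> {..2::nat} \<and> card S = 1) = (S \<in> {{0}, {1}, {2}})"
    "(S \<subseteq> {..2::nat} \<and> card S = 2) = (S \<in> {{0, 1}, {0, 2}, {1, 2}})" for S
    unfolding Pow
    by (simp_all add: Pow_insert conj_disj_distribR del: card_eq_0_iff cong: conj_cong)
  then show "{S. S \<subseteq> {..2::nat} \<and> card S = 0} = {{}}"
    "{S. S \<subseteq> {..2::nat} \<and> card S = 1} = {{0}, {1}, {2}}"
    "{S. S \<subseteq> {..2::nat} \<and> card S = 2} = {{0, 1}, {0, 2}, {1, 2}}"
    by (simp_all only: Collect_mem_eq)
qed

text \<open>The formula of \<^const>\<open>rb_bracket\<close> for a map whose values lie in another space: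
  the \<open>V\<close>-component of the bracket \<open>[_, _, _]\<^sub>R\<close> on \<open>A \<oplus> V\<close>.\<close>

definition rb_twist ::
  "'k::field \<Rightarrow> ('k \<Rightarrow> 'v::ab_group_add \<Rightarrow> 'v) \<Rightarrow> ('a \<Rightarrow> 'a) \<Rightarrow>
    ('a \<Rightarrow> 'a \<Rightarrow> 'a \<Rightarrow> 'v) \<Rightarrow> 'a \<Rightarrow> 'a \<Rightarrow> 'a \<Rightarrow> 'v" where
  "rb_twist lam sV R psi x y z =
    psi (R x) (R y) z + psi (R x) y (R z) + psi x (R y) (R z)
    + sV lam (psi (R x) y z + psi x (R y) z + psi x y (R z))
    + sV (lam ^ 2) (psi x y z)"

text \<open>The sums over subsets with 0, 1 and 2 elements have the weights \<open>\<lambda>\<^sup>2\<close>,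
  \<open>\<lambda>\<close> and 1, as in \<open>[_, _, _]\<^sub>R\<close>.\<close>

lemma rb_delta_trilinear:
  assumes "vector_space sV"
  shows "rb_delta lam R sV RV (cochain_of_trilinear psi) [(x, y)] z =
    psi (R x) (R y) (R z) - RV (rb_twist lam sV R psi x y z)"
proof -
  interpret vector_space sV by fact
  have sum_positions: "partial_R R k (cochain_of_trilinear psi) [(x, y)] z =
      (\<Sum>S | S \<subseteq> {..2} \<and> card S = k.
        psi (apply_at R S 0 x) (apply_at R S 1 y) (apply_at R S 2 z))" for k
    by (simp add: partial_R_def cochain_of_trilinear_def)
  have "partial_R R 0 (cochain_of_trilinear psi) [(x, y)] z = psi x y z"
    unfolding sum_positions subsets_of_three_positions by (simp add: apply_at_def)
  moreover have "partial_R R 1 (cochain_of_trilinear psi) [(x, y)] z =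
      psi (R x) y z + psi x (R y) z + psi x y (R z)"
    unfolding sum_positions subsets_of_three_positions by (simp add: apply_at_def add.assoc)
  moreover have "partial_R R 2 (cochain_of_trilinear psi) [(x, y)] z =
      psi (R x) (R y) z + psi (R x) y (R z) + psi x (R y) (R z)"
    unfolding sum_positions subsets_of_three_positions
    by (simp add: apply_at_def add.assoc doubleton_eq_iff)
  ultimately show ?thesis
    by (simp add: rb_delta_def rb_twist_def cochain_of_trilinear_def numeral_2_eq_2
        algebra_simps)
qed

section \<open>The axioms on the direct sum\<close>

locale rb_algebra_with_module =
  A: rota_baxter_3lie_algebra lam sA br R +
  V: rota_baxter_3lie_algebra lam sV "\<lambda>_ _ _. 0" RV
  for lam :: "'k::field"
    and sA :: "'k \<Rightarrow> 'a::ab_group_add \<Rightarrow> 'a"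
    and br :: "'a \<Rightarrow> 'a \<Rightarrow> 'a \<Rightarrow> 'a"
    and R :: "'a \<Rightarrow> 'a"
    and sV :: "'k \<Rightarrow> 'v::ab_group_add \<Rightarrow> 'v"
    and RV :: "'v \<Rightarrow> 'v"
begin

sublocale AV: vector_space_prod sA sV
  by unfold_locales

text \<open>The off-diagonal entry \<open>G\<close> is the second component of the map on \<open>A \<oplus> 0\<close>, as
  \<open>H 0 = 0\<close>. This serves \<open>R\<^sub>\<chi>\<close> with \<open>H = R\<^sub>V\<close>, and
  the bracket, which ignores the \<open>V\<close>-parts of its arguments, with \<open>H = 0\<close>.\<close>

lemma linear_triangular_iff:
  assumes "Vector_Spaces.linear sA sA F" and "Vector_Spaces.linear sV sV H"
  shows "Vector_Spaces.linear AV.scale AV.scale (\<lambda>q. (F (fst q), H (snd q) + G (fst q)))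
    \<longleftrightarrow> Vector_Spaces.linear sA sV G" (is "?L \<longleftrightarrow> ?R")
proof -
  interpret F: Vector_Spaces.linear sA sA F by fact
  interpret H: Vector_Spaces.linear sV sV H by fact
  show ?thesis
  proof
    assume ?L
    then have add: "\<And>u v. H (snd (u + v)) + G (fst (u + v))
          = (H (snd u) + G (fst u)) + (H (snd v) + G (fst v))"
      and scale: "\<And>c u. H (snd (AV.scale c u)) + G (fst (AV.scale c u))
          = sV c (H (snd u) + G (fst u))"
      by (simp_all add: Vector_Spaces.linear_iff AV.scale_def)
    show ?R
      using add[of "(x, 0)" "(y, 0)" for x y] scale[of _ "(x, 0)" for x]
      by (simp add: Vector_Spaces.linear_iff AV.scale_def H.zero
          A.vector_space_axioms V.vector_space_axioms)
  next
    assume ?R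
    then interpret G: Vector_Spaces.linear sA sV G .
    show ?L
      by (simp add: Vector_Spaces.linear_iff AV.scale_def AV.p.vector_space_axioms
          F.add F.scale H.add H.scale G.add G.scale algebra_simps)
  qed
qed

lemma linear_base_components_iff:
  assumes "Vector_Spaces.linear sA sA F"
  shows "Vector_Spaces.linear AV.scale AV.scale (\<lambda>q. (F (fst q), G (fst q)))
    \<longleftrightarrow> Vector_Spaces.linear sA sV G"
proof -
  have "Vector_Spaces.linear sV sV (\<lambda>_. 0)"
    by (simp add: Vector_Spaces.linear_iff V.vector_space_axioms)
  from linear_triangular_iff[OF assms this] show ?thesis by simp
qed

lemma psi_bracket_conv:
  "psi_bracket br psi u v w =
    (br (fst u) (fst v) (fst w), psi (fst u) (fst v) (fst w))"
  by (simp add: psi_bracket_def split_beta)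

lemma chi_operator_conv:
  "chi_operator R RV chi = (\<lambda>u. (R (fst u), RV (snd u) + chi (fst u)))"
  by (auto simp: chi_operator_def)

lemma three_lie_psi_bracket_iff:
  "three_lie_algebra AV.scale (psi_bracket br psi) \<longleftrightarrow>
    alternating_trilinear sA sV psi \<and>
    (\<forall>x1 x2 y1 y2 y3. psi x1 x2 (br y1 y2 y3) =
      psi (br x1 x2 y1) y2 y3 + psi y1 (br x1 x2 y2) y3 + psi y1 y2 (br x1 x2 y3))"
  (is "_ \<longleftrightarrow> _ \<and> ?fund")
proof -
  let ?B = "psi_bracket br psi"
  have all_A: "(\<forall>u :: 'a \<times> 'v. P (fst u)) \<longleftrightarrow> (\<forall>x. P x)" for P
    by auto
  \<comment> \<open>The varying slot is instantiated explicitly, as the pattern \<open>G (fst q)\<close> has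
    several higher-order matches.\<close>
  note linear_1 = linear_base_components_iff[OF A.linear_1, where G = "\<lambda>t. psi t _ _"]
    and linear_2 = linear_base_components_iff[OF A.linear_2, where G = "\<lambda>t. psi _ t _"]
    and linear_3 = linear_base_components_iff[OF A.linear_3, where G = "\<lambda>t. psi _ _ t"]
  have "three_lie_algebra AV.scale ?B \<longleftrightarrow>
    (\<forall>v w. Vector_Spaces.linear AV.scale AV.scale (\<lambda>u. ?B u v w)) \<and>
    (\<forall>u w. Vector_Spaces.linear AV.scale AV.scale (\<lambda>v. ?B u v w)) \<and>
    (\<forall>u v. Vector_Spaces.linear AV.scale AV.scale (\<lambda>w. ?B u v w)) \<and>
    (\<forall>u v. ?B u u v = 0 \<and> ?B u v v = 0 \<and> ?B u v u = 0) \<and>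
    (\<forall>u1 u2 v1 v2 v3. ?B u1 u2 (?B v1 v2 v3) =
        ?B (?B u1 u2 v1) v2 v3 + ?B v1 (?B u1 u2 v2) v3 + ?B v1 v2 (?B u1 u2 v3))"
    unfolding three_lie_algebra_def three_lie_algebra_axioms_def
    using AV.p.vector_space_axioms by blast
  also have "\<dots> \<longleftrightarrow> alternating_trilinear sA sV psi \<and> ?fund"
    unfolding alternating_trilinear_def psi_bracket_conv
    \<comment> \<open>The fundamental identity of \<open>A\<close> is used from right to left, since its right-hand
      side contains instances of its left-hand side.\<close>
    by (simp add: linear_1 linear_2 linear_3 A.alternating
        zero_prod_def all_A A.fundamental_identity[symmetric])
  finally show ?thesis .
qed

text \<open>The bracket sees only the \<open>A\<close>-parts of its arguments, and the \<open>A\<close>-part of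
  \<open>R\<^sub>\<chi>(x + a)\<close> is \<open>R(x)\<close>. So in the Rota-Baxter identity \<open>R\<^sub>V\<close> and
  \<open>\<chi>\<close> occur only through the outer operator.\<close>

lemma rb_bracket_psi_bracket:
  "rb_bracket lam AV.scale (psi_bracket br psi) (chi_operator R RV chi) u v w =
    (rb_bracket lam sA br R (fst u) (fst v) (fst w),
     rb_twist lam sV R psi (fst u) (fst v) (fst w))"
  by (simp add: rb_bracket_def rb_twist_def psi_bracket_conv chi_operator_conv AV.scale_def)

theorem rota_baxter_psi_chi_iff_2cocycle:
  "rota_baxter_3lie_algebra lam AV.scale (psi_bracket br psi) (chi_operator R RV chi) \<longleftrightarrow>
    rb_2cocycle lam sA br R sV RV trivial_rho
      (cochain_of_trilinear psi) (cochain_of_linear chi)"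
proof -
  let ?psi_closed = "\<forall>x1 x2 y1 y2 y3. psi x1 x2 (br y1 y2 y3) =
      psi (br x1 x2 y1) y2 y3 + psi y1 (br x1 x2 y2) y3 + psi y1 y2 (br x1 x2 y3)"
  let ?chi_bounds = "\<forall>x y z. psi (R x) (R y) (R z) =
      RV (rb_twist lam sV R psi x y z) + chi (rb_bracket lam sA br R x y z)"
  have all_3: "(\<forall>u v w :: 'a \<times> 'v. P (fst u) (fst v) (fst w)) \<longleftrightarrow> (\<forall>x y z. P x y z)" for P
    by auto
  have operator_linear: "Vector_Spaces.linear AV.scale AV.scale (chi_operator R RV chi) \<longleftrightarrow>
      Vector_Spaces.linear sA sV chi"
    unfolding chi_operator_conv by (rule linear_triangular_iff[OF A.linear_R V.linear_R])
  have rota_baxter: "(\<forall>u v w. psi_bracket br psi (chi_operator R RV chi u)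
        (chi_operator R RV chi v) (chi_operator R RV chi w) =
      chi_operator R RV chi
        (rb_bracket lam AV.scale (psi_bracket br psi) (chi_operator R RV chi) u v w))
      \<longleftrightarrow> ?chi_bounds"
    unfolding rb_bracket_psi_bracket
    by (simp add: psi_bracket_conv chi_operator_conv A.rota_baxter all_3)
  have len_2: "(\<forall>Xs z. length Xs = 2 \<longrightarrow> P Xs z) \<longleftrightarrow>
      (\<forall>x1 x2 y1 y2 z. P [(x1, x2), (y1, y2)] z)" for P :: "('a \<times> 'a) list \<Rightarrow> 'a \<Rightarrow> bool"
    by (auto simp: numeral_2_eq_2 length_Suc_conv)
  have len_1: "(\<forall>Xs z. length Xs = 1 \<longrightarrow> P Xs z) \<longleftrightarrow> (\<forall>x y z. P [(x, y)] z)"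
    for P :: "('a \<times> 'a) list \<Rightarrow> 'a \<Rightarrow> bool"
    by (auto simp: length_Suc_conv)
  have "rota_baxter_3lie_algebra lam AV.scale (psi_bracket br psi) (chi_operator R RV chi) \<longleftrightarrow>
      alternating_trilinear sA sV psi \<and> Vector_Spaces.linear sA sV chi
      \<and> ?psi_closed \<and> ?chi_bounds"
    unfolding rota_baxter_3lie_algebra_def rota_baxter_3lie_algebra_axioms_def
      three_lie_psi_bracket_iff operator_linear rota_baxter by blast
  also have "\<dots> \<longleftrightarrow> rb_2cocycle lam sA br R sV RV trivial_rho
      (cochain_of_trilinear psi) (cochain_of_linear chi)"
    unfolding rb_2cocycle_def is_cochain_of_trilinear_iff is_cochain_of_linear_iff len_1 len_2
      coboundary_2_trivial[OF V.vector_space_axioms]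
      coboundary_1_trivial[OF V.vector_space_axioms V.linear_R]
      rb_delta_trilinear[OF V.vector_space_axioms]
    by (simp add: algebra_simps)
  finally show ?thesis .
qed

end

section \<open>The criterion for a section of a central extension\<close>

theorem proposition5p4:
  fixes lam :: "'k::field"
    and sA :: "'k \<Rightarrow> 'a::ab_group_add \<Rightarrow> 'a"
    and brA :: "'a \<Rightarrow> 'a \<Rightarrow> 'a \<Rightarrow> 'a"
    and R :: "'a \<Rightarrow> 'a"
    and sV :: "'k \<Rightarrow> 'v::ab_group_add \<Rightarrow> 'v"
    and RV :: "'v \<Rightarrow> 'v"
    and sE :: "'k \<Rightarrow> 'e::ab_group_add \<Rightarrow> 'e"
    and brE :: "'e \<Rightarrow> 'e \<Rightarrow> 'e \<Rightarrow> 'e"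
    and RE :: "'e \<Rightarrow> 'e"
    and i :: "'v \<Rightarrow> 'e"
    and p :: "'e \<Rightarrow> 'a"
    and s :: "'a \<Rightarrow> 'e"
    and psi :: "'a \<Rightarrow> 'a \<Rightarrow> 'a \<Rightarrow> 'v"
    and chi :: "'a \<Rightarrow> 'v"
  assumes algebra_A: "rota_baxter_3lie_algebra lam sA brA R"
    and abelian_V: "rota_baxter_3lie_algebra lam sV (\<lambda>_ _ _. 0) RV"
    and extension: "rb_central_extension lam sA brA R sV RV sE brE RE i p"
    and section_linear: "Vector_Spaces.linear sA sE s"
    and right_inverse: "\<And>x. p (s x) = x"
    and psi: "\<And>x y z. i (psi x y z) = brE (s x) (s y) (s z) - s (brA x y z)"
    and chi: "\<And>x. i (chi x) = RE (s x) - s (R x)"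
  shows "rota_baxter_3lie_algebra lam (module_prod.scale sA sV)
            (psi_bracket brA psi) (chi_operator R RV chi) \<longleftrightarrow>
         rb_2cocycle lam sA brA R sV RV trivial_rho
            (cochain_of_trilinear psi) (cochain_of_linear chi)"
proof -
  interpret A: rota_baxter_3lie_algebra lam sA brA R by fact
  interpret V: rota_baxter_3lie_algebra lam sV "\<lambda>_ _ _. 0" RV by fact
  interpret rb_algebra_with_module lam sA brA R sV RV by unfold_locales
  show ?thesis by (rule rota_baxter_psi_chi_iff_2cocycle)
qed

end
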